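(* Let $\mathbb{F}$ be an algebraically closed field of characteristic $0$. Let $n\in\mathbb{F}[x]\setminus\{0\}$, and let $A\subset\mathbb{F}[x]$ be a Diophantine tuple with property $D_k(n)$, where $k\ge 18$ is an integer. There do not exist pairwise distinct $a_1,a_2,a_3,b_1,b_2,b_3\in A$ such that $$a_i b_j+n\neq 0\qquad(1\le i,j\le 3)$$ and $$\frac{(a_1b_1+n)(a_2b_2+n)}{(a_1b_2+n)(a_2b_1+n)}\notin\mathbb{F}^\times.$$
   Context: A set $A\subset \mathbb{F}[x]$ is called a Diophantine tuple with property $D_k(n)$ if $ab+n$ is a $k$-th power in $\mathbb{F}[x]$ for all distinct $a,b\in A$. The zero polynomial is regarded as a $k$-th power. Here $\mathbb{F}^\times=\mathbb{F}\setminus\{0\}$ is viewed inside $\mathbb{F}(x)$. *)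

theory Defs
  imports "HOL-Computational_Algebra.Computational_Algebra"
begin

(* No finiteness of A is required. For k > 0 the zero polynomial satisfies is_nth_power k,
   since 0 = 0 ^ k, so the convention that 0 counts as a k-th power needs no extra clause. *)
definition diophantine_tuple :: "nat \<Rightarrow> 'a::field poly \<Rightarrow> 'a poly set \<Rightarrow> bool" where
  "diophantine_tuple k n A \<longleftrightarrow> (\<forall>a\<in>A. \<forall>b\<in>A. a \<noteq> b \<longrightarrow> is_nth_power k (a * b + n))"

(* The nonzero constants, as a subset of the rational function field F(x) = Frac(F[x]). *)
definition nonzero_constants :: "'a::field poly fract set" where
  "nonzero_constants = {to_fract [:c:] | c. c \<noteq> 0}"

end

theory Submission
  imports Defs "Jordan_Normal_Form.Determinant"
begin

text \<open>
  The matrix \<open>M i j = a i * b j + n\<close> has rank at most 2, so the Leibniz expansion of its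
  \<open>3 \<times> 3\<close> determinant is a vanishing sum of six \<open>k\<close>-th powers up to sign. A Wronskian argument of
  Mason--Stothers type shows that a minimal linear relation between at least three polynomials, all
  of whose vanishing orders are multiples of \<open>k \<ge> 18\<close>, is impossible for at most five polynomials,
  and also for these six: the even and the odd terms have the same product up to sign, so at no point
  does exactly one term have an order different from that of the other five.
  Hence the terms in each proportionality class sum to zero. An even and an odd term never
  cancel, since the \<open>2 \<times> 2\<close> minors \<open>n * (a i - a i') * (b j - b j')\<close> of \<open>M\<close> are nonzero;
  counting parities, and comparing the products of the even and the odd terms,
  leaves only one class. So the terms of the identity and of a transposition are proportional.
\<close>

hide_const (open) Module.smult

section \<open>Wronskians of polynomials\<close>

definition wronskian :: "nat \<Rightarrow> (nat \<Rightarrow> 'a::field_char_0 poly) \<Rightarrow> 'a poly" where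
  "wronskian r f = det (mat r r (\<lambda>(i, j). (pderiv ^^ j) (f i)))"

lemma wronskian_leibniz:
  "wronskian r f =
     (\<Sum>p | p permutes {0..<r}. signof p * (\<Prod>i = 0..<r. (pderiv ^^ p i) (f i)))"
  unfolding wronskian_def
  by (subst det_def'[of _ r]) (auto intro!: sum.cong prod.cong simp: permutes_in_image)

lemma wronskian_add_row:
  assumes "i < r" "j < r" "i \<noteq> j"
  shows "wronskian r (f(j := f j + smult c (f i))) = wronskian r f"
proof -
  let ?A = "mat r r (\<lambda>(i, j). (pderiv ^^ j) (f i))"
  have "mat r r (\<lambda>(l, m). (pderiv ^^ m) ((f(j := f j + smult c (f i))) l)) = addrow [:c:] j i ?A"
    using assms by (intro eq_matI) (auto simp: higher_pderiv_add higher_pderiv_smult mat_addrow_def)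
  then show ?thesis
    using assms det_addrow[of i r j ?A "[:c:]"] by (simp add: wronskian_def)
qed

lemma wronskian_smult_row:
  assumes "j < r"
  shows "wronskian r (f(j := smult c (f j))) = smult c (wronskian r f)"
proof -
  let ?A = "mat r r (\<lambda>(i, j). (pderiv ^^ j) (f i))"
  have "mat r r (\<lambda>(l, m). (pderiv ^^ m) ((f(j := smult c (f j))) l)) = multrow j [:c:] ?A"
    using assms by (intro eq_matI) (auto simp: higher_pderiv_smult mat_multrow_def)
  then show ?thesis
    using assms det_multrow[of j r ?A "[:c:]"] by (simp add: wronskian_def)
qed

text \<open>When \<open>r + 1\<close> polynomials sum to zero, any \<open>r\<close> of them have the
  same Wronskian up to sign, so the omitted one can be chosen afresh at each point. The proof
  negates row \<open>j\<close> and subtracts the other rows one at a time.\<close>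

lemma wronskian_replace_row:
  assumes "j < r" "f r = - (\<Sum>i<r. f i)"
  shows "wronskian r (f(j := f r)) = - wronskian r f"
proof -
  have *: "wronskian r (f(j := smult (-1) (f j) + (\<Sum>i\<in>S. smult (-1) (f i)))) = - wronskian r f"
    if "finite S" "S \<subseteq> {..<r} - {j}" for S
    using that
  proof (induction S rule: finite_induct)
    case empty
    then show ?case using wronskian_smult_row[OF assms(1), of f "-1"] by (simp add: fun_upd_def)
  next
    case (insert x S)
    let ?g = "f(j := smult (-1) (f j) + (\<Sum>i\<in>S. smult (-1) (f i)))"
    have "f(j := smult (-1) (f j) + (\<Sum>i\<in>insert x S. smult (-1) (f i)))
        = ?g(j := ?g j + smult (-1) (?g x))"
      using insert.hyps insert.prems by (auto simp: fun_eq_iff algebra_simps)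
    then show ?case
      using wronskian_add_row[of x r j ?g "-1"] insert assms(1) by (auto simp: fun_upd_def)
  qed
  have "(\<Sum>i<r. f i) = f j + (\<Sum>i\<in>{..<r} - {j}. f i)"
    using assms(1) by (intro sum.remove) auto
  then have "f r = smult (-1) (f j) + (\<Sum>i\<in>{..<r} - {j}. smult (-1) (f i))"
    using assms(2) by (simp add: sum_negf)
  then show ?thesis using *[of "{..<r} - {j}"] by simp
qed

section \<open>Vanishing order and degree of the Wronskian\<close>

lemma sum_permutes_in_imageThan:
  "p permutes {0..<r} \<Longrightarrow> (\<Sum>i<r. p i) = (\<Sum>i<r. i :: nat)"
  using sum.permute[of p "{0..<r}" "\<lambda>x. x"] by (simp add: atLeast0LessThan o_def)

text \<open>Each derivative lowers the vanishing order at \<open>c\<close> by at most one; once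
  \<open>m\<close> reaches \<open>v\<close>, the truncated exponent makes the claim trivial.\<close>

lemma linear_power_dvd_higher_pderiv:
  fixes p :: "'a::field_char_0 poly"
  assumes "[:-c, 1:] ^ v dvd p"
  shows "[:-c, 1:] ^ (v - m) dvd (pderiv ^^ m) p"
proof (induction m)
  case 0
  then show ?case using assms by simp
next
  case (Suc m)
  show ?case
  proof (cases "v - m")
    case 0
    then show ?thesis by simp
  next
    case (Suc n)
    then obtain q where q: "(pderiv ^^ m) p = [:-c, 1:] ^ Suc n * q"
      using Suc.IH by (auto elim: dvdE)
    have "pderiv ([:-c, 1:] ^ Suc n * q)
        = [:-c, 1:] ^ n * ([:-c, 1:] * pderiv q + smult (of_nat (Suc n)) q)"
      by (subst pderiv_mult, subst pderiv_power_Suc) (simp add: algebra_simps pderiv_pCons)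
    moreover have "v - Suc m = n" using Suc by simp
    ultimately show ?thesis using q by (metis dvd_triv_left funpow.simps(2) o_apply)
  qed
qed

text \<open>In a Leibniz term row \<open>i\<close> is differentiated \<open>p i\<close> times, which
  costs at most 0 + 1 + ... + (r - 1) orders in total.\<close>

lemma wronskian_dvd:
  assumes "\<And>i. i < r \<Longrightarrow> [:-c, 1:] ^ v i dvd f i"
  shows "[:-c, 1:] ^ ((\<Sum>i<r. v i) - (\<Sum>i<r. i)) dvd wronskian r f"
  unfolding wronskian_leibniz
proof (intro dvd_sum dvd_mult, goal_cases)
  case (1 p)
  have "(\<Sum>i<r. v i) \<le> (\<Sum>i<r. (v i - p i) + p i)"
    by (intro sum_mono) auto
  also have "\<dots> = (\<Sum>i<r. v i - p i) + (\<Sum>i<r. i)"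
    using 1 sum_permutes_in_imageThan[of p r] by (simp add: sum.distrib)
  finally have "(\<Sum>i<r. v i) - (\<Sum>i<r. i) \<le> (\<Sum>i<r. v i - p i)" by simp
  then have "[:-c, 1:] ^ ((\<Sum>i<r. v i) - (\<Sum>i<r. i)) dvd [:-c, 1:] ^ (\<Sum>i<r. v i - p i)"
    by (rule le_imp_power_dvd)
  also have "\<dots> = (\<Prod>i = 0..<r. [:-c, 1:] ^ (v i - p i))"
    by (simp add: power_sum atLeast0LessThan)
  also have "\<dots> dvd (\<Prod>i = 0..<r. (pderiv ^^ p i) (f i))"
    using assms by (intro prod_dvd_prod linear_power_dvd_higher_pderiv) auto
  finally show ?case .
qed

text \<open>Differentiation takes 0 + 1 + ... + (r - 1) off the total degree in each nonzero Leibniz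
  term. The additive form avoids truncated subtraction.\<close>

lemma degree_wronskian:
  assumes "wronskian r f \<noteq> 0"
  shows "degree (wronskian r f) + (\<Sum>i<r. i) \<le> (\<Sum>i<r. degree (f i))"
proof -
  let ?t = "\<lambda>p. signof p * (\<Prod>i = 0..<r. (pderiv ^^ p i) (f i))"
  have *: "degree (?t p) + (\<Sum>i<r. i) \<le> (\<Sum>i<r. degree (f i))"
    if p: "p permutes {0..<r}" and nz: "?t p \<noteq> 0" for p
  proof -
    have nz': "(pderiv ^^ p i) (f i) \<noteq> 0" if "i < r" for i
      using nz that by auto
    have le: "p i \<le> degree (f i)" if "i < r" for i
    proof (rule ccontr)
      assume "\<not> p i \<le> degree (f i)"
      then obtain m where m: "p i = Suc m" "degree (f i) \<le> m" by (cases "p i") auto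
      have "degree ((pderiv ^^ m) (f i)) = 0" using m by (simp add: degree_higher_pderiv)
      then have "(pderiv ^^ p i) (f i) = 0" using m by (simp add: pderiv_eq_0_iff)
      then show False using nz' that by auto
    qed
    have "degree (?t p) \<le> (\<Sum>i = 0..<r. degree ((pderiv ^^ p i) (f i)))"
      using degree_prod_sum_le[of "{0..<r}" "\<lambda>i. (pderiv ^^ p i) (f i)"]
      by (simp add: sign_def o_def)
    also have "\<dots> = (\<Sum>i<r. degree (f i) - p i)"
      by (simp add: degree_higher_pderiv atLeast0LessThan)
    finally have "degree (?t p) + (\<Sum>i<r. p i) \<le> (\<Sum>i<r. (degree (f i) - p i) + p i)"
      by (simp add: sum.distrib)
    also have "\<dots> = (\<Sum>i<r. degree (f i))"
      using le by (intro sum.cong) auto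
    finally show ?thesis using sum_permutes_in_imageThan[OF p] by simp
  qed
  from assms obtain p where "p permutes {0..<r}" "?t p \<noteq> 0"
    unfolding wronskian_leibniz by (metis (mono_tags, lifting) mem_Collect_eq sum.neutral)
  then have le: "(\<Sum>i<r. i) \<le> (\<Sum>i<r. degree (f i))" using * by fastforce
  have "degree (wronskian r f) \<le> (\<Sum>i<r. degree (f i)) - (\<Sum>i<r. i)"
    unfolding wronskian_leibniz
  proof (rule degree_sum_le)
    show "degree (?t p) \<le> (\<Sum>i<r. degree (f i)) - (\<Sum>i<r. i)" if "p \<in> {p. p permutes {0..<r}}" for p
    proof (cases "?t p = 0")
      case True
      then show ?thesis by (simp only: degree_0)
    next
      case False
      then show ?thesis using *[of p] that by simp
    qed
  qed (simp add: finite_permutations)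
  then show ?thesis using le by simp
qed

section \<open>Nonvanishing of the Wronskian of independent polynomials\<close>

lemma coeff_prod_sum:
  assumes "finite S" "\<And>i. i \<in> S \<Longrightarrow> degree (f i) \<le> e i"
  shows "coeff (\<Prod>i\<in>S. f i) (\<Sum>i\<in>S. e i) = (\<Prod>i\<in>S. coeff (f i) (e i :: nat) :: 'a::field)"
  using assms
proof (induction S rule: finite_induct)
  case (insert x S)
  have d: "degree (\<Prod>i\<in>S. f i) \<le> (\<Sum>i\<in>S. e i)"
    using degree_prod_sum_le[of S f] insert sum_mono[of S "\<lambda>i. degree (f i)" e]
    by (force simp: o_def)
  have dx: "degree (f x) \<le> e x" using insert by simp
  have "coeff (f x * (\<Prod>i\<in>S. f i)) (e x + (\<Sum>i\<in>S. e i)) = coeff (f x) (e x) * coeff (\<Prod>i\<in>S. f i) (\<Sum>i\<in>S. e i)"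
  proof (cases "degree (f x) = e x \<and> degree (\<Prod>i\<in>S. f i) = (\<Sum>i\<in>S. e i)")
    case True
    then show ?thesis using coeff_mult_degree_sum[of "f x" "\<Prod>i\<in>S. f i"] by simp
  next
    case False
    then have "degree (f x) + degree (\<Prod>i\<in>S. f i) < e x + (\<Sum>i\<in>S. e i)" using d dx by linarith
    then have "coeff (f x * (\<Prod>i\<in>S. f i)) (e x + (\<Sum>i\<in>S. e i)) = 0"
      by (meson coeff_eq_0 degree_mult_le le_less_trans)
    moreover have "coeff (f x) (e x) = 0 \<or> coeff (\<Prod>i\<in>S. f i) (\<Sum>i\<in>S. e i) = 0"
      using False d dx by (metis coeff_eq_0 le_neq_implies_less)
    ultimately show ?thesis by auto
  qed
  then show ?case using insert by simp
qed simp

text \<open>The falling factorial d (d - 1) ... (d - m + 1), the factor that the \<open>m\<close>-th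
  derivative puts on x^d. Subtraction takes place in the field, so the product is also meaningful,
  namely zero, for \<open>d < m\<close>.\<close>

definition falling :: "nat \<Rightarrow> nat \<Rightarrow> 'a::field_char_0" where
  "falling d m = (\<Prod>l<m. of_nat d - of_nat l)"

lemma falling_eq_0_iff: "falling d m = (0 :: 'a::field_char_0) \<longleftrightarrow> d < m"
  by (auto simp: falling_def)

lemma coeff_higher_pderiv_falling:
  "m \<le> d \<Longrightarrow> coeff ((pderiv ^^ m) f) (d - m) = falling d m * coeff f d"
proof (induction m)
  case (Suc m)
  have "coeff ((pderiv ^^ Suc m) f) (d - Suc m) = of_nat (d - m) * coeff ((pderiv ^^ m) f) (d - m)"
    using Suc.prems by (simp add: coeff_pderiv Suc_diff_Suc del: of_nat_Suc)
  then show ?case using Suc by (simp add: falling_def of_nat_diff algebra_simps)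
qed (simp add: falling_def)

text \<open>A Vandermonde argument in the basis of falling factorials: a kernel vector is the
  coefficient vector of a polynomial of degree below \<open>r\<close> that vanishes at the
  \<open>r\<close> distinct points \<open>d i\<close>.\<close>

lemma det_falling_nonzero:
  fixes l :: "nat \<Rightarrow> 'a::field_char_0"
  assumes inj: "inj_on d {..<r}" and l: "\<And>i. i < r \<Longrightarrow> l i \<noteq> 0"
  shows "det (mat r r (\<lambda>(i, j). falling (d i) j * l i)) \<noteq> 0"
proof
  let ?A = "mat r r (\<lambda>(i, j). falling (d i) j * l i)"
  assume "det ?A = 0"
  then obtain v where v: "v \<in> carrier_vec r" "v \<noteq> 0\<^sub>v r" "?A *\<^sub>v v = 0\<^sub>v r"
    using det_0_iff_vec_prod_zero_field[of ?A r] by auto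
  define Q where "Q = (\<Sum>j<r. smult (v $ j) (\<Prod>m<j. [:- of_nat m, 1:]))"
  have polyQ: "poly Q (of_nat x) = (\<Sum>j<r. v $ j * falling x j)" for x
    by (simp add: Q_def poly_sum poly_prod falling_def)
  have root: "poly Q (of_nat (d i)) = 0" if "i < r" for i
  proof -
    have "0 = (?A *\<^sub>v v) $ i" using v that by simp
    also have "\<dots> = (\<Sum>j<r. falling (d i) j * l i * v $ j)"
      using that v(1) by (simp add: scalar_prod_def atLeast0LessThan)
    also have "\<dots> = l i * poly Q (of_nat (d i))"
      by (simp add: polyQ sum_distrib_left algebra_simps)
    finally show ?thesis using l[OF that] by simp
  qed
  have "Q = 0"
  proof (rule ccontr)
    assume Q: "Q \<noteq> 0"
    then have r: "r > 0" by (auto simp: Q_def intro!: Nat.gr0I)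
    have "degree Q \<le> r - 1"
      unfolding Q_def
    proof (rule degree_sum_le)
      fix j assume "j \<in> {..<r}"
      have "degree (\<Prod>m<j. [:- of_nat m, 1 :: 'a:]) \<le> j"
        using degree_prod_sum_le[of "{..<j}" "\<lambda>m. [:- of_nat m, 1 :: 'a:]"] by simp
      then show "degree (smult (v $ j) (\<Prod>m<j. [:- of_nat m, 1:])) \<le> r - 1"
        using \<open>j \<in> {..<r}\<close> degree_smult_le[of "v $ j" "\<Prod>m<j. [:- of_nat m, 1 :: 'a:]"] by (auto simp del: degree_smult_eq)
    qed simp
    moreover have "card ((\<lambda>i. of_nat (d i) :: 'a) ` {..<r}) = r"
      using inj by (subst card_image) (auto simp: inj_on_def)
    moreover have "(\<lambda>i. of_nat (d i) :: 'a) ` {..<r} \<subseteq> {x. poly Q x = 0}"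
      using root by auto
    ultimately have "r \<le> r - 1"
      by (metis Q card_mono card_poly_roots_bound le_trans poly_roots_finite)
    then show False using r by simp
  qed
  \<comment> \<open>At the point \<open>j\<close>, the first index with a nonzero coefficient, the
    later terms vanish because \<open>falling j m = 0\<close> for \<open>m > j\<close>; what remains
    is a nonzero multiple of j!.\<close>
  obtain j where j: "j < r" "v $ j \<noteq> 0" "\<And>m. m < j \<Longrightarrow> v $ m = 0"
  proof -
    have "\<exists>j. j < r \<and> v $ j \<noteq> 0" using v(1,2) by (auto simp: vec_eq_iff)
    then show ?thesis
      using that exists_least_iff[of "\<lambda>j. j < r \<and> v $ j \<noteq> 0"] by (metis less_trans)
  qed
  have "0 = poly Q (of_nat j)" using \<open>Q = 0\<close> by simp
  also have "\<dots> = (\<Sum>m<r. if m = j then v $ j * falling j j else 0)"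
    unfolding polyQ
  proof (intro sum.cong refl)
    fix m
    show "v $ m * falling j m = (if m = j then v $ j * falling j j else 0)"
      using j(3)[of m] falling_eq_0_iff[of j m, where 'a = 'a] by (cases m j rule: linorder_cases) auto
  qed
  also have "\<dots> = v $ j * falling j j" using j(1) by simp
  finally show False using j(2) by (simp add: falling_eq_0_iff)
qed

text \<open>The coefficient in the top possible degree \<open>N\<close> is a determinant of falling
  factorials scaled by leading coefficients.\<close>

lemma wronskian_nonzero_distinct_degrees:
  assumes inj: "inj_on (\<lambda>i. degree (f i)) {..<r}" and nz: "\<And>i. i < r \<Longrightarrow> f i \<noteq> 0"
  shows "wronskian r f \<noteq> 0"
proof -
  define d where "d = (\<lambda>i. degree (f i))"
  define N where "N = (\<Sum>i<r. d i) - (\<Sum>i<r. i)"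
  have "coeff (wronskian r f) N = det (mat r r (\<lambda>(i, j). falling (d i) j * lead_coeff (f i)))"
    unfolding wronskian_leibniz coeff_sum
  proof (subst det_def'[of _ r], simp, intro sum.cong refl, goal_cases)
    case (1 p)
    then have p: "p permutes {0..<r}" by simp
    have "coeff (\<Prod>i = 0..<r. (pderiv ^^ p i) (f i)) N = (\<Prod>i = 0..<r. falling (d i) (p i) * lead_coeff (f i))"
    proof (cases "\<forall>i<r. p i \<le> d i")
      case True
      have "(\<Sum>i<r. d i) = (\<Sum>i<r. (d i - p i) + p i)"
        using True by (intro sum.cong) auto
      then have "N = (\<Sum>i = 0..<r. d i - p i)"
        using sum_permutes_in_imageThan[OF p] by (simp add: N_def sum.distrib atLeast0LessThan)
      then have "coeff (\<Prod>i = 0..<r. (pderiv ^^ p i) (f i)) N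
          = (\<Prod>i = 0..<r. coeff ((pderiv ^^ p i) (f i)) (d i - p i))"
        by (simp add: coeff_prod_sum degree_higher_pderiv d_def)
      also have "\<dots> = (\<Prod>i = 0..<r. falling (d i) (p i) * lead_coeff (f i))"
        using True by (intro prod.cong) (auto simp: coeff_higher_pderiv_falling d_def)
      finally show ?thesis .
    next
      \<comment> \<open>If \<open>d i < p i\<close>, the derivative and the falling factorial both
        vanish, so the value of \<open>N\<close> is irrelevant here.\<close>
      case False
      then obtain i where i: "i < r" "d i < p i" by auto
      then obtain m where m: "p i = Suc m" "d i \<le> m" by (cases "p i") auto
      have "degree ((pderiv ^^ m) (f i)) = 0" using m by (simp add: degree_higher_pderiv d_def)
      then have "(pderiv ^^ p i) (f i) = 0" using m by (simp add: pderiv_eq_0_iff)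
      then have 1: "(\<Prod>i = 0..<r. (pderiv ^^ p i) (f i)) = 0"
        using i by (intro prod_zero) auto
      have 2: "(\<Prod>i = 0..<r. falling (d i) (p i) * lead_coeff (f i)) = 0"
        using i by (intro prod_zero) (auto simp: falling_eq_0_iff intro!: bexI[of _ i])
      show ?thesis by (simp only: 1 2 coeff_0)
    qed
    then show ?case using p by (auto simp: sign_def permutes_in_image)
  qed
  moreover have "\<dots> \<noteq> 0"
    using inj nz by (intro det_falling_nonzero) (auto simp: d_def)
  ultimately show ?thesis by auto
qed

lemma wronskian_zero_row: "i < r \<Longrightarrow> f i = 0 \<Longrightarrow> wronskian r f = 0"
  using wronskian_smult_row[of i r f 0] by (metis fun_upd_triv smult_0_left)

text \<open>A family of minimal total degree among those reachable by row operations has distinct degrees.\<close>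

lemma wronskian_nonzero:
  fixes f :: "nat \<Rightarrow> 'a::field_char_0 poly"
  assumes indep: "\<And>c i. (\<Sum>i<r. smult (c i) (f i)) = 0 \<Longrightarrow> i < r \<Longrightarrow> c i = 0"
  shows "wronskian r f \<noteq> 0"
proof -
  \<comment> \<open>Row operations are tracked only through what they preserve: the Wronskian and
    linear independence.\<close>
  define P where "P g \<longleftrightarrow> wronskian r g = wronskian r f \<and>
    (\<forall>c. (\<Sum>i<r. smult (c i) (g i)) = 0 \<longrightarrow> (\<forall>i<r. c i = 0))" for g :: "nat \<Rightarrow> 'a poly"
  have "P f" using indep by (auto simp: P_def)
  then obtain g where g: "P g"
    and min: "\<And>h. P h \<Longrightarrow> (\<Sum>i<r. degree (g i)) \<le> (\<Sum>i<r. degree (h i))"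
    using ex_has_least_nat[of P f "\<lambda>g. \<Sum>i<r. degree (g i)"] by blast
  have add: "P (g(j := g j + smult a (g i)))" if "i < r" "j < r" "i \<noteq> j" for i j a
    unfolding P_def
  proof (intro conjI allI impI)
    show "wronskian r (g(j := g j + smult a (g i))) = wronskian r f"
      using wronskian_add_row[OF that, of g a] g by (simp add: P_def)
  next
    fix c l assume c: "(\<Sum>l<r. smult (c l) ((g(j := g j + smult a (g i))) l)) = 0" and l: "l < r"
    define c' where "c' = c(i := c i + c j * a)"
    have "(\<Sum>l<r. smult (c l) ((g(j := g j + smult a (g i))) l))
        = (\<Sum>l<r. smult (c l) (g l) + (if l = j then smult (c j * a) (g i) else 0))"
      by (intro sum.cong) (auto simp: smult_add_right)
    also have "\<dots> = (\<Sum>l<r. smult (c l) (g l)) + smult (c j * a) (g i)"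
      using that by (simp add: sum.distrib)
    also have "\<dots> = (\<Sum>l<r. smult (c l) (g l) + (if l = i then smult (c j * a) (g i) else 0))"
      using that by (simp add: sum.distrib)
    also have "\<dots> = (\<Sum>l<r. smult (c' l) (g l))"
      by (intro sum.cong) (auto simp: c'_def smult_add_left)
    finally have c'0: "c' l = 0" if "l < r" for l using c g that by (simp add: P_def)
    have "c j = 0" using c'0[of j] that by (simp add: c'_def)
    then show "c l = 0" using c'0[OF l] by (auto simp: c'_def split: if_splits)
  qed
  have nz: "h i \<noteq> 0" if "P h" "i < r" for h i
  proof
    assume "h i = 0"
    then have "(\<Sum>l<r. smult (if l = i then 1 else 0) (h l)) = 0"
      by (intro sum.neutral) auto
    moreover have "\<forall>c. (\<Sum>i<r. smult (c i) (h i)) = 0 \<longrightarrow> (\<forall>i<r. c i = 0)"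
      using that by (simp add: P_def)
    ultimately have "\<forall>m<r. (if m = i then 1 else (0::'a)) = 0"
      by (elim allE[where x = "\<lambda>l. if l = i then 1 else 0"]) simp
    then show False using that by auto
  qed
  have "inj_on (\<lambda>i. degree (g i)) {..<r}"
  proof (rule inj_onI, rule ccontr)
    fix i j assume ij: "i \<in> {..<r}" "j \<in> {..<r}" and deg: "degree (g i) = degree (g j)" and "i \<noteq> j"
    \<comment> \<open>With equal degrees, this \<open>a\<close> cancels the leading coefficients and
      lowers the total degree, against minimality.\<close>
    define a where "a = - lead_coeff (g j) / lead_coeff (g i)"
    define h where "h = g(j := g j + smult a (g i))"
    have "P h" unfolding h_def using add ij \<open>i \<noteq> j\<close> by simp
    have gi: "g i \<noteq> 0" using nz[OF g] ij by simp
    have "coeff (h j) (degree (g j)) = 0" using gi by (simp add: h_def a_def deg[symmetric])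
    moreover have "degree (h j) \<le> degree (g j)"
      using deg by (simp add: h_def) (metis degree_add_le degree_smult_le order_refl)
    moreover have "h j \<noteq> 0" using nz[OF \<open>P h\<close>] ij by simp
    ultimately have "degree (h j) < degree (g j)"
      by (metis le_neq_implies_less leading_coeff_0_iff)
    then have "(\<Sum>i<r. degree (h i)) < (\<Sum>i<r. degree (g i))"
      using ij by (intro sum_strict_mono_ex1) (auto simp: h_def)
    then show False using min[OF \<open>P h\<close>] by simp
  qed
  then have "wronskian r g \<noteq> 0"
    using wronskian_nonzero_distinct_degrees nz[OF g] by blast
  then show ?thesis using g by (simp add: P_def)
qed

text \<open>A family of maximal total order at \<open>c\<close> among those reachable by row operations has distinct orders.\<close>

lemma wronskian_orders:
  fixes f :: "nat \<Rightarrow> 'a::field_char_0 poly"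
  assumes W: "wronskian r f \<noteq> 0" and v: "\<And>i. i < r \<Longrightarrow> v i \<le> order c (f i)"
  obtains w where "inj_on w {..<r}" "\<And>i. i < r \<Longrightarrow> v i \<le> w i"
    "(\<Sum>i<r. w i) \<le> order c (wronskian r f) + (\<Sum>i<r. i)"
proof -
  define P where "P g \<longleftrightarrow> wronskian r g = wronskian r f \<and> (\<forall>i<r. v i \<le> order c (g i))"
    for g :: "nat \<Rightarrow> 'a poly"
  \<comment> \<open>A nonzero Wronskian caps the total order, so a family of maximal total order
    exists.\<close>
  have bound: "(\<Sum>i<r. order c (g i)) \<le> order c (wronskian r f) + (\<Sum>i<r. i)" if "P g" for g
  proof -
    have "[:-c, 1:] ^ ((\<Sum>i<r. order c (g i)) - (\<Sum>i<r. i)) dvd wronskian r g"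
      by (intro wronskian_dvd order_1)
    then have "(\<Sum>i<r. order c (g i)) - (\<Sum>i<r. i) \<le> order c (wronskian r f)"
      using that W by (simp add: P_def order_divides)
    then show ?thesis by simp
  qed
  have "P f" using v by (auto simp: P_def)
  moreover have "\<forall>g. P g \<longrightarrow> (\<Sum>i<r. order c (g i)) < Suc (order c (wronskian r f) + (\<Sum>i<r. i))"
    using bound by (auto simp: less_Suc_eq_le)
  ultimately obtain g where g: "P g"
    and max: "\<And>h. P h \<Longrightarrow> (\<Sum>i<r. order c (h i)) \<le> (\<Sum>i<r. order c (g i))"
    using ex_has_greatest_nat[of P f "\<lambda>g. \<Sum>i<r. order c (g i)"] by blast
  have nz: "h i \<noteq> 0" if "P h" "i < r" for h i
    using wronskian_zero_row[of i r h] that W by (auto simp: P_def)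
  have "inj_on (\<lambda>i. order c (g i)) {..<r}"
  proof (rule inj_onI, rule ccontr)
    fix i j assume ij: "i \<in> {..<r}" "j \<in> {..<r}"
      and ord: "order c (g i) = order c (g j)" and "i \<noteq> j"
    obtain p where p: "g i = [:-c, 1:] ^ order c (g i) * p" "\<not> [:-c, 1:] dvd p"
      using order_decomp[of "g i" c] nz[OF g, of i] ij by auto
    obtain q where q: "g j = [:-c, 1:] ^ order c (g i) * q"
      using order_decomp[of "g j" c] nz[OF g, of j] ij ord by auto
    have pc: "poly p c \<noteq> 0" using p(2) by (simp add: poly_eq_0_iff_dvd)
    \<comment> \<open>This \<open>a\<close> makes the cofactor \<open>q + smult a p\<close> vanish
      at \<open>c\<close>, so the order of row \<open>j\<close> rises, against maximality.\<close>
    define a where "a = - poly q c / poly p c"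
    define h where "h = g(j := g j + smult a (g i))"
    have hj: "h j = [:-c, 1:] ^ order c (g i) * (q + smult a p)"
      by (simp add: h_def) (subst p(1), subst q, simp add: algebra_simps)
    have "poly (q + smult a p) c = 0" using pc by (simp add: a_def)
    then have "[:-c, 1:] dvd q + smult a p" by (rule poly_eq_0_iff_dvd[THEN iffD1])
    then have dvd: "[:-c, 1:] ^ Suc (order c (g i)) dvd h j"
      unfolding hj by (metis mult.commute mult_dvd_mono dvd_refl power_Suc)
    have Wh: "wronskian r h = wronskian r f"
      unfolding h_def using wronskian_add_row[of i r j g a] ij \<open>i \<noteq> j\<close> g by (simp add: P_def)
    then have "h j \<noteq> 0" using wronskian_zero_row[of j r h] W ij by auto
    then have less: "order c (g j) < order c (h j)"
      using dvd ord by (simp only: order_divides) simp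
    then have "P h"
      using g Wh by (auto simp: P_def h_def intro: order_trans less_imp_le)
    have "(\<Sum>i<r. order c (g i)) < (\<Sum>i<r. order c (h i))"
      using ij less by (intro sum_strict_mono_ex1) (auto simp: h_def)
    then show False using max[OF \<open>P h\<close>] by simp
  qed
  then show ?thesis
    using that[of "\<lambda>i. order c (g i)"] bound[OF g] g by (simp add: P_def)
qed

section \<open>Orders against degrees, and the local inequality at a point\<close>

text \<open>Over an algebraically closed field the roots counted with multiplicity exhaust the
  degree. \<open>S\<close> may contain further points, so one set can serve several
  polynomials.\<close>

lemma sum_order_eq_degree:
  fixes p :: "'a::alg_closed_field poly"
  assumes "p \<noteq> 0" "finite S" "{x. poly p x = 0} \<subseteq> S"
  shows "(\<Sum>c\<in>S. order c p) = degree p"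
  using assms
proof (induction p rule: poly_root_order_induct)
  case 0
  then show ?case by simp
next
  case (no_roots p)
  then have "degree p = 0"
    using alg_closed_imp_poly_has_root[of p] by blast
  moreover have "order c p = 0" for c using no_roots by (simp add: order_0I)
  ultimately show ?case by simp
next
  case (root p x n)
  have p: "p \<noteq> 0" using root by auto
  have x: "x \<in> S" using root by auto
  have ord: "order c ([:-x, 1:] ^ n * p) = (if c = x then n else 0) + order c p" for c
  proof -
    have "order c ([:-x, 1:] ^ n) = (if c = x then n else 0)"
      by (auto simp: order_power_n_n intro!: order_0I)
    then show ?thesis using root p by (subst order_mult) auto
  qed
  have "(\<Sum>c\<in>S. order c ([:-x, 1:] ^ n * p)) = n + (\<Sum>c\<in>S. order c p)"
    unfolding ord using x root by (simp add: sum.distrib)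
  also have "\<dots> = n + degree p" using root p by auto
  also have "\<dots> = degree ([:-x, 1:] ^ n * p)"
    using p by (simp add: degree_mult_eq degree_power_eq)
  finally show ?case .
qed

text \<open>The least case is \<open>v\<close>, \<open>v + 1\<close>, \<open>v + 2\<close> and so
  on. Induction removes the largest value: the \<open>n + 1\<close> distinct values lie between
  \<open>v\<close> and this maximum, which is therefore at least \<open>v + n\<close>.\<close>

lemma sum_inj_on_ge:
  fixes w :: "'b \<Rightarrow> nat"
  assumes "finite T" "inj_on w T" "\<And>i. i \<in> T \<Longrightarrow> v \<le> w i"
  shows "card T * v + (\<Sum>i<card T. i) \<le> (\<Sum>i\<in>T. w i)"
  using assms
proof (induction "card T" arbitrary: T)
  case 0
  then show ?case by simp
next
  case (Suc n)
  have ne: "T \<noteq> {}" using Suc.hyps(2) by auto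
  have "Max (w ` T) \<in> w ` T" using ne Suc.prems by (intro Max_in) auto
  then obtain x where x: "x \<in> T" "w x = Max (w ` T)" by auto
  have "w ` T \<subseteq> {v..w x}" using Suc.prems x by auto
  then have "card (w ` T) \<le> card {v..w x}" by (intro card_mono) auto
  then have wx: "v + n \<le> w x" using Suc.hyps(2) Suc.prems(3)[OF x(1)] card_image[OF Suc.prems(2)] by simp
  have "card (T - {x}) = n" using Suc x by simp
  then have "n * v + (\<Sum>i<n. i) \<le> (\<Sum>i\<in>T - {x}. w i)"
    using Suc.hyps(1)[of "T - {x}"] Suc.prems by (auto intro: inj_on_diff)
  moreover have "(\<Sum>i\<in>T. w i) = w x + (\<Sum>i\<in>T - {x}. w i)"
    using x Suc.prems by (intro sum.remove) auto
  ultimately show ?case using wx unfolding Suc.hyps(2)[symmetric] by simp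
qed

text \<open>
  Here \<open>v i\<close> are the orders at a point of the terms of a minimal relation, and \<open>w\<close> the distinct orders
  given by \<open>wronskian_orders\<close> when the term \<open>m\<close> is dropped. The bound 18 is sharp for \<open>r = 5\<close> with
  exactly two non-minimal orders, both equal to 18 plus the minimal one.
\<close>

lemma local_weight_ineq:
  fixes v w :: "nat \<Rightarrow> nat"
  assumes r: "2 \<le> r" "r \<le> 5" and k: "18 \<le> k" and dvd: "\<And>i. i \<le> r \<Longrightarrow> k dvd v i"
    and m: "m \<le> r" "\<And>i. i \<le> r \<Longrightarrow> v m \<le> v i"
    and inj: "inj_on w ({..r} - {m})" and w: "\<And>i. i \<in> {..r} - {m} \<Longrightarrow> v i \<le> w i"
    and single: "r = 5 \<Longrightarrow> card {i\<in>{..r}. v i \<noteq> v m} \<noteq> 1"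
  shows "r * (\<Sum>i\<le>r. v i) + (r + 1) * (\<Sum>i<r. i) \<le> (r + 1) * (\<Sum>i\<in>{..r} - {m}. w i)"
proof -
  \<comment> \<open>\<open>U\<close> collects the terms above the minimum, \<open>T\<close> those at
    the minimum apart from \<open>m\<close>, and \<open>X\<close> is the total excess over the
    minimum.\<close>
  define U where "U = {i\<in>{..r}. v i \<noteq> v m}"
  define T where "T = {i\<in>{..r} - {m}. v i = v m}"
  define x where "x i = v i - v m" for i
  define X where "X = (\<Sum>i\<in>U. x i)"
  have fin: "finite U" "finite T" by (auto simp: U_def T_def)
  have part: "{..r} - {m} = T \<union> U" "T \<inter> U = {}" by (auto simp: T_def U_def)
  have cards: "card T + card U = r"
    using card_Un_disjoint[OF fin(2,1) part(2)] m(1) by (simp flip: part(1))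
  have vx: "v i = v m + x i" if "i \<le> r" for i using m(2)[OF that] by (simp add: x_def)
  have kx: "k dvd x i" if "i \<le> r" for i using dvd m(1) that by (simp add: x_def dvd_diff_nat)
  have x_ge: "18 \<le> x i" if "i \<in> U" for i
  proof -
    have "x i > 0" using that m(2)[of i] by (auto simp: U_def x_def)
    then show ?thesis using kx[of i] that k by (auto simp: U_def dest!: dvd_imp_le)
  qed
  have X_ge: "18 * card U \<le> X"
    using sum_mono[of U "\<lambda>_. 18" x] x_ge by (simp add: X_def)
  have "(\<Sum>i\<le>r. v i) = (\<Sum>i\<le>r. v m + x i)" using vx by (intro sum.cong) auto
  also have "\<dots> = (r + 1) * v m + (\<Sum>i\<le>r. x i)" by (simp add: sum.distrib)
  also have "(\<Sum>i\<le>r. x i) = X"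
    unfolding X_def by (rule sum.mono_neutral_right) (auto simp: U_def x_def)
  finally have sumv: "(\<Sum>i\<le>r. v i) = (r + 1) * v m + X" .
  have sumw: "(\<Sum>i\<in>{..r} - {m}. w i) = (\<Sum>i\<in>T. w i) + (\<Sum>i\<in>U. w i)"
    unfolding part(1) by (rule sum.union_disjoint) (use fin part in auto)
  have T_ge: "card T * v m + (\<Sum>i<card T. i) \<le> (\<Sum>i\<in>T. w i)"
  proof (intro sum_inj_on_ge)
    show "inj_on w T" using inj by (rule inj_on_subset) (auto simp: T_def)
    show "v m \<le> w i" if "i \<in> T" for i using w[of i] that by (auto simp: T_def)
  qed (fact fin)
  have wU: "v m + x i \<le> w i" if "i \<in> U" for i
  proof -
    have "i \<in> {..r} - {m}" using that by (auto simp: U_def)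
    then show ?thesis using w[of i] vx[of i] by simp
  qed
  have U_ge: "card U * v m + X \<le> (\<Sum>i\<in>U. w i)"
    using sum_mono[of U "\<lambda>i. v m + x i" w] wU by (simp add: X_def sum.distrib)
  \<comment> \<open>For \<open>r = 5\<close> and two elements in \<open>U\<close>,
    \<open>X_ge\<close> gives only 36, while 42 would be needed. Equal excesses gain 1 from the
    distinctness of \<open>w\<close>; unequal ones differ by at least \<open>k\<close>, so that
    \<open>X\<close> is at least 18 + 36.\<close>
  have two: "54 \<le> X \<or> card U * v m + X + 1 \<le> (\<Sum>i\<in>U. w i)" if u2: "card U = 2"
  proof -
    obtain a b where ab: "U = {a, b}" "a \<noteq> b" using u2 by (auto simp: card_2_iff)
    have abr: "a \<le> r" "b \<le> r" "a \<noteq> m" "b \<noteq> m" using ab by (auto simp: U_def)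
    show ?thesis
    proof (cases "x a = x b")
      case True
      have "w a \<noteq> w b" using inj ab abr by (auto simp: inj_on_def)
      then show ?thesis using True wU[of a] wU[of b] ab by (simp add: X_def)
    next
      case False
      have *: "36 \<le> p" if "k dvd p" "k dvd q" "q < p" "18 \<le> q" for p q
      proof -
        have "k dvd p - q" using that by (simp add: dvd_diff_nat)
        then have "k \<le> p - q" using that by (intro dvd_imp_le) auto
        then show ?thesis using k that by simp
      qed
      have "36 \<le> x a \<or> 36 \<le> x b"
        using False *[of "x a" "x b"] *[of "x b" "x a"] kx abr x_ge ab by (metis insertI1 insertI2 linorder_neqE_nat)
      then show ?thesis using x_ge[of a] x_ge[of b] ab by (auto simp: X_def)
    qed
  qed
  \<comment> \<open>With \<open>r = 5\<close> and one element in \<open>U\<close>, \<open>X\<close>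
    would have to be at least 24, which \<open>k = 18\<close> does not guarantee; hence the
    hypothesis \<open>single\<close>.\<close>
  have excl: "\<not> (r = 5 \<and> card U = 1)" using single by (auto simp: U_def)
  define t where "t = card T"
  define u where "u = card U"
  define WT where "WT = (\<Sum>i\<in>T. w i)"
  define WU where "WU = (\<Sum>i\<in>U. w i)"
  \<comment> \<open>The multiples of \<open>v m\<close> cancel and leave a numerical condition;
    \<open>e\<close> is a gain on \<open>U\<close> from the distinctness of
    \<open>w\<close>.\<close>
  have red: ?thesis if "(r + 1) * (\<Sum>i<r. i) \<le> X + (r + 1) * ((\<Sum>i<t. i) + e)" "u * v m + X + e \<le> WU" for e
  proof -
    have "r * (\<Sum>i\<le>r. v i) + (r + 1) * (\<Sum>i<r. i) \<le> r * ((r + 1) * v m + X) + X + (r + 1) * ((\<Sum>i<t. i) + e)"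
      unfolding sumv using that(1) by simp
    also have "\<dots> = (r + 1) * (r * v m + X + ((\<Sum>i<t. i) + e))" by (simp add: algebra_simps)
    also have "\<dots> \<le> (r + 1) * (WT + WU)"
    proof (rule mult_left_mono)
      have "r * v m = t * v m + u * v m" using cards by (simp add: t_def u_def algebra_simps flip: add_mult_distrib)
      then show "r * v m + X + ((\<Sum>i<t. i) + e) \<le> WT + WU"
        using T_ge that(2) unfolding WT_def[symmetric] t_def[symmetric] by simp
    qed simp
    finally show ?thesis unfolding sumw WT_def WU_def .
  qed
  have gauss: "(\<Sum>i<n. i) = n * (n - 1) div 2" for n :: nat
    using gauss_sum_nat[of "n - 1"] by (cases n) (auto simp: lessThan_Suc_atMost atLeast0AtMost mult.commute)
  have tu: "t = r - u" "u \<le> r" using cards by (auto simp: t_def u_def)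
  note facts = X_ge[folded u_def] excl[folded u_def] U_ge[folded u_def WU_def]
  show ?thesis
  proof (cases "u = 2 \<and> X < 54 \<and> r = 5")
    case True
    then have "u * v m + X + 1 \<le> WU" using two by (simp add: u_def WU_def)
    then show ?thesis using True facts tu by (intro red[of 1]) (auto simp: gauss)
  next
    case False
    have "r \<in> {2, 3, 4, 5}" using r by auto
    moreover have "u \<in> {0, 1, 2, 3, 4, 5}" using r tu by auto
    ultimately have "(r + 1) * (\<Sum>i<r. i) \<le> X + (r + 1) * ((\<Sum>i<t. i) + 0)"
      using False facts(1,2) tu unfolding gauss insert_iff empty_iff by (elim disjE) simp_all
    then show ?thesis using facts(3) by (intro red[of 0]) simp_all
  qed
qed

section \<open>Linear relations between polynomials with highly divisible orders\<close>

text \<open>Mason-Stothers counting. Let D be the total degree of the \<open>r + 1\<close> terms.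
  The local bounds, summed over all roots, give r D \<le> (r + 1) deg W; the degree bound, summed
  over the omitted term, gives (r + 1) (deg W + 0 + ... + (r - 1)) \<le> r D. These conflict once r
  \<ge> 2.\<close>

lemma wronskian_circuit_contradiction:
  fixes f :: "nat \<Rightarrow> 'a::{alg_closed_field, field_char_0} poly"
  assumes r: "2 \<le> r" "r \<le> 5" and k: "18 \<le> k"
    and nz: "\<And>i. i \<le> r \<Longrightarrow> f i \<noteq> 0" and dvd: "\<And>i c. i \<le> r \<Longrightarrow> k dvd order c (f i)"
    and sum0: "(\<Sum>i\<le>r. f i) = 0" and W: "wronskian r f \<noteq> 0"
    and single: "\<And>c m. r = 5 \<Longrightarrow> m \<le> r \<Longrightarrow> card {i\<in>{..r}. order c (f i) \<noteq> order c (f m)} \<noteq> 1"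
  shows False
proof -
  have "(\<Sum>i\<le>r. f i) = f r + (\<Sum>i<r. f i)"
    by (simp add: lessThan_Suc_atMost[symmetric] add.commute)
  then have fr: "f r = - (\<Sum>i<r. f i)" using sum0 by (simp add: add_eq_0_iff2)
  define g where "g m = f(m := f r)" for m
  \<comment> \<open>\<open>g m\<close> omits \<open>f m\<close> and stores \<open>f r\<close> in row
    \<open>m\<close>; \<open>\<tau> m\<close> sends each remaining index to its row.\<close>
  define \<tau> where "\<tau> m j = (if j = r then m else j)" for m j :: nat
  have \<tau>: "bij_betw (\<tau> m) ({..r} - {m}) {..<r}" if "m \<le> r" for m
    using that by (intro bij_betwI[where g = "\<lambda>i. if i = m then r else i"]) (auto simp: \<tau>_def split: if_splits)
  have g\<tau>: "g m (\<tau> m j) = f j" if "j \<in> {..r} - {m}" for m j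
    using that by (auto simp: g_def \<tau>_def)
  have Wg: "wronskian r (g m) = wronskian r f \<or> wronskian r (g m) = - wronskian r f" if "m \<le> r" for m
  proof (cases "m = r")
    case True
    then show ?thesis by (simp add: g_def)
  next
    case False
    then show ?thesis using wronskian_replace_row[of m r f] fr that by (simp add: g_def)
  qed
  have local: "r * (\<Sum>i\<le>r. order c (f i)) \<le> (r + 1) * order c (wronskian r f)" for c
  proof -
    \<comment> \<open>At each point the omitted term is one of least order there.\<close>
    obtain m where m: "m \<le> r" "\<And>i. i \<le> r \<Longrightarrow> order c (f m) \<le> order c (f i)"
      using ex_min_if_finite[of "{..r}"] arg_min_if_finite[of "{..r}" "\<lambda>i. order c (f i)"]
      by (metis atMost_iff empty_iff finite_atMost le0 linorder_not_less)
    have Wm: "wronskian r (g m) \<noteq> 0" "order c (wronskian r (g m)) = order c (wronskian r f)"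
      using Wg[OF m(1)] W by auto
    obtain w where w: "inj_on w {..<r}" "\<And>i. i < r \<Longrightarrow> order c (g m i) \<le> w i"
      "(\<Sum>i<r. w i) \<le> order c (wronskian r (g m)) + (\<Sum>i<r. i)"
      using wronskian_orders[OF Wm(1), of "\<lambda>i. order c (g m i)" c] by auto
    have "r * (\<Sum>i\<le>r. order c (f i)) + (r + 1) * (\<Sum>i<r. i)
        \<le> (r + 1) * (\<Sum>j\<in>{..r} - {m}. w (\<tau> m j))"
    proof (rule local_weight_ineq[OF r k, where v = "\<lambda>i. order c (f i)" and m = m])
      show "inj_on (\<lambda>j. w (\<tau> m j)) ({..r} - {m})"
        using comp_inj_on[of "\<tau> m" "{..r} - {m}" w] \<tau>[OF m(1)] w(1) by (simp add: bij_betw_def o_def)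
      show "order c (f j) \<le> w (\<tau> m j)" if "j \<in> {..r} - {m}" for j
        using w(2)[of "\<tau> m j"] g\<tau>[OF that] \<tau>[OF m(1)] that by (auto simp: bij_betw_def)
    qed (use single m dvd in auto)
    also have "(\<Sum>j\<in>{..r} - {m}. w (\<tau> m j)) = (\<Sum>i<r. w i)"
      by (rule sum.reindex_bij_betw[OF \<tau>[OF m(1)]])
    also have "(r + 1) * \<dots> \<le> (r + 1) * (order c (wronskian r f) + (\<Sum>i<r. i))"
      using w(3) unfolding Wm(2) by (rule mult_le_mono2)
    finally show ?thesis by (simp add: algebra_simps)
  qed
  define S where "S = {x. poly (wronskian r f * (\<Prod>i\<le>r. f i)) x = 0}"
  have finS: "finite S"
    unfolding S_def using W nz by (intro poly_roots_finite) auto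
  have degW: "(\<Sum>c\<in>S. order c (wronskian r f)) = degree (wronskian r f)"
    using W finS by (intro sum_order_eq_degree) (auto simp: S_def)
  have degf: "(\<Sum>c\<in>S. order c (f i)) = degree (f i)" if "i \<le> r" for i
    using nz that finS by (intro sum_order_eq_degree) (auto simp: S_def poly_prod)
  have "(\<Sum>i\<le>r. degree (f i)) = (\<Sum>i\<le>r. \<Sum>c\<in>S. order c (f i))"
    by (intro sum.cong) (auto simp: degf)
  also have "\<dots> = (\<Sum>c\<in>S. \<Sum>i\<le>r. order c (f i))"
    by (rule sum.swap)
  finally have "r * (\<Sum>i\<le>r. degree (f i)) = (\<Sum>c\<in>S. r * (\<Sum>i\<le>r. order c (f i)))"
    by (simp add: sum_distrib_left)
  also have "\<dots> \<le> (\<Sum>c\<in>S. (r + 1) * order c (wronskian r f))"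
    by (intro sum_mono local)
  also have "\<dots> = (r + 1) * degree (wronskian r f)"
    by (simp only: sum_distrib_left[symmetric] degW)
  finally have lower: "r * (\<Sum>i\<le>r. degree (f i)) \<le> (r + 1) * degree (wronskian r f)" .
  have upper: "degree (wronskian r f) + (\<Sum>i<r. i) + degree (f m) \<le> (\<Sum>i\<le>r. degree (f i))" if "m \<le> r" for m
  proof -
    have "degree (wronskian r f) + (\<Sum>i<r. i) \<le> (\<Sum>i<r. degree (g m i))"
      using degree_wronskian[of r "g m"] Wg[OF that] W by auto
    also have "\<dots> = (\<Sum>j\<in>{..r} - {m}. degree (g m (\<tau> m j)))"
      by (rule sum.reindex_bij_betw[OF \<tau>[OF that], symmetric])
    also have "\<dots> = (\<Sum>j\<in>{..r} - {m}. degree (f j))"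
      by (intro sum.cong refl) (simp add: g\<tau>)
    finally show ?thesis using that by (simp add: sum.remove[of "{..r}" m])
  qed
  have "(\<Sum>m\<le>r. degree (wronskian r f) + (\<Sum>i<r. i) + degree (f m)) \<le> (\<Sum>m\<le>r. \<Sum>i\<le>r. degree (f i))"
    by (intro sum_mono upper) simp
  then have "(r + 1) * (degree (wronskian r f) + (\<Sum>i<r. i)) \<le> r * (\<Sum>i\<le>r. degree (f i))"
    by (simp add: sum.distrib algebra_simps)
  then have "(r + 1) * (degree (wronskian r f) + (\<Sum>i<r. i)) \<le> (r + 1) * degree (wronskian r f)"
    using lower by (rule order_trans)
  then have "(r + 1) * degree (wronskian r f) + (r + 1) * (\<Sum>i<r. i) \<le> (r + 1) * degree (wronskian r f)"
    by (simp only: add_mult_distrib2)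
  then have "(\<Sum>i<r. i) = 0" by simp
  then show False using r by (auto simp: sum_eq_0_iff dest!: bspec[of _ _ 1])
qed

section \<open>Proportionality classes and linear independence\<close>

text \<open>The arguments of \<open>order\<close> are swapped so that \<open>orders p\<close> is the
  whole divisor of \<open>p\<close>, a single object that can label a proportionality class.\<close>

definition orders :: "'a::idom poly \<Rightarrow> 'a \<Rightarrow> nat" where
  "orders p c = order c p"

lemma orders_smult: "a \<noteq> 0 \<Longrightarrow> orders (smult a p) = orders p"
  by (simp add: orders_def fun_eq_iff order_smult)

text \<open>Common roots are split off from both polynomials by induction on the degree; without
  roots both are constants.\<close>

lemma orders_eq_imp_smult:
  fixes p q :: "'a::alg_closed_field poly"
  assumes "p \<noteq> 0" "q \<noteq> 0" "orders p = orders q"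
  obtains a where "a \<noteq> 0" "p = smult a q"
proof -
  have "\<exists>a. a \<noteq> 0 \<and> p = smult a q"
    using assms
  proof (induction "degree p" arbitrary: p q rule: less_induct)
    case less
    have ord: "order c p = order c q" for c using less.prems(3) by (metis orders_def)
    show ?case
    proof (cases "\<exists>c. poly p c = 0")
      case True
      then obtain c where c: "poly p c = 0" by blast
      then have "poly q c = 0" using ord[of c] less.prems by (simp add: order_root)
      then obtain p' q' where pq: "p = [:-c, 1:] * p'" "q = [:-c, 1:] * q'"
        using c by (auto simp: poly_eq_0_iff_dvd elim!: dvdE)
      have nz: "p' \<noteq> 0" "q' \<noteq> 0" using pq less.prems by auto
      have "order x p' = order x q'" for x
        using ord[of x] less.prems(1,2) unfolding pq by (simp add: order_mult del: mult_pCons_left)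
      moreover have "degree p' < degree p" using nz pq by (simp add: degree_mult_eq del: mult_pCons_left)
      ultimately obtain a where "a \<noteq> 0" "p' = smult a q'"
        using less.hyps[of p' q'] nz by (auto simp: orders_def fun_eq_iff)
      then show ?thesis using pq by (intro exI[of _ a]) (simp del: mult_pCons_left)
    next
      case False
      then have "\<not> (\<exists>c. poly q c = 0)"
        using ord less.prems by (metis order_root)
      with False have "degree p = 0" "degree q = 0"
        using alg_closed_imp_poly_has_root[of p] alg_closed_imp_poly_has_root[of q] by auto
      then obtain x y where "p = [:x:]" "q = [:y:]" by (auto elim!: degree_eq_zeroE)
      then show ?thesis using less.prems by (intro exI[of _ "x / y"]) auto
    qed
  qed
  then show ?thesis using that by blast
qed

text \<open>By strong induction on \<open>card J\<close>, a nontrivial relation has only nonzero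
  coefficients, and dropping one term leaves independent polynomials, whose Wronskian is nonzero.
  With three or more terms this contradicts the Mason-Stothers count; two terms would be
  proportional, against the distinct orders.\<close>

lemma linear_independent_powers:
  fixes f :: "'b \<Rightarrow> 'a::{alg_closed_field, field_char_0} poly"
  assumes k: "18 \<le> k" and "finite J" "card J \<le> 5"
    and "\<And>j. j \<in> J \<Longrightarrow> f j \<noteq> 0" "\<And>j c. j \<in> J \<Longrightarrow> k dvd order c (f j)"
    and "inj_on (\<lambda>j. orders (f j)) J"
    and "(\<Sum>j\<in>J. smult (a j) (f j)) = 0" "j \<in> J"
  shows "a j = 0"
  using assms(2-)
proof (induction "card J" arbitrary: J a j rule: less_induct)
  case less
  define J' where "J' = {j\<in>J. a j \<noteq> 0}"
  have sub: "J' \<subseteq> J" by (auto simp: J'_def)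
  have sum': "(\<Sum>j\<in>J'. smult (a j) (f j)) = 0"
    using less.prems(6) sum.mono_neutral_right[of J J' "\<lambda>j. smult (a j) (f j)"] less.prems(1)
    by (auto simp: J'_def)
  show ?case
  proof (rule ccontr)
    assume aj: "a j \<noteq> 0"
    have "J' = J"
    proof (rule ccontr)
      assume "J' \<noteq> J"
      then have "card J' < card J" using sub less.prems(1) by (simp add: psubset_card_mono psubset_eq)
      then have "a j = 0"
        using less.prems sub sum' aj less.hyps[of J' a j] finite_subset[OF sub less.prems(1)]
          inj_on_subset[OF less.prems(5) sub] by (auto simp: J'_def)
      then show False using aj by simp
    qed
    then have anz: "a i \<noteq> 0" if "i \<in> J" for i using that by (auto simp: J'_def)
    obtain r where r: "card J = Suc r"
      using less.prems(1,7) by (metis card_gt_0_iff empty_iff gr0_conv_Suc)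
    obtain h where h: "bij_betw h {..r} J"
      using ex_bij_betw_nat_finite[OF less.prems(1)] r
      by (auto simp: atLeast0LessThan lessThan_Suc_atMost)
    have hJ: "h i \<in> J" if "i \<le> r" for i using h that by (auto simp: bij_betw_def)
    have hinj: "inj_on h {..r}" using h by (simp add: bij_betw_def)
    define g where "g i = smult (a (h i)) (f (h i))" for i
    have gnz: "g i \<noteq> 0" if "i \<le> r" for i using hJ[OF that] anz less.prems(3) by (simp add: g_def)
    have gord: "order c (g i) = order c (f (h i))" if "i \<le> r" for i c
      using hJ[OF that] anz by (simp add: g_def order_smult)
    have sumg: "(\<Sum>i\<le>r. g i) = 0"
      using less.prems(6) sum.reindex_bij_betw[OF h, of "\<lambda>j. smult (a j) (f j)"] by (simp add: g_def)
    have "wronskian r g \<noteq> 0"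
    proof (rule wronskian_nonzero)
      fix c i assume c: "(\<Sum>i<r. smult (c i) (g i)) = 0" and i: "i < r"
      define J0 where "J0 = h ` {..<r}"
      define b where "b j = c (the_inv_into {..r} h j) * a j" for j
      have b: "b (h i) = c i * a (h i)" if "i \<le> r" for i
        using that by (simp add: b_def the_inv_into_f_f[OF hinj])
      have J0: "J0 \<subseteq> J" using hJ by (auto simp: J0_def)
      have inj0: "inj_on h {..<r}" using hinj by (rule inj_on_subset) auto
      have card0: "card J0 = r" unfolding J0_def using card_image[OF inj0] by simp
      have "(\<Sum>j\<in>J0. smult (b j) (f j)) = (\<Sum>i<r. smult (c i) (g i))"
        unfolding J0_def by (subst sum.reindex[OF inj0]) (auto intro!: sum.cong simp: b g_def)
      then have sumb: "(\<Sum>j\<in>J0. smult (b j) (f j)) = 0" using c by simp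
      have "b (h i) = 0"
      proof (rule less.hyps[of J0])
        show "f j \<noteq> 0" "k dvd order c (f j)" if "j \<in> J0" for j c
          using that J0 less.prems(3,4) by auto
        show "inj_on (\<lambda>j. orders (f j)) J0" by (rule inj_on_subset[OF less.prems(5) J0])
      qed (use card0 r less.prems(2) sumb i in \<open>auto simp: J0_def\<close>)
      then show "c i = 0" using b[of i] anz hJ[of i] i by simp
    qed
    moreover have "2 \<le> r"
    proof (rule ccontr)
      assume "\<not> 2 \<le> r"
      then consider "r = 0" | "r = 1" by linarith
      then show False
      proof cases
        case 1
        then show False using sumg gnz[of 0] by simp
      next
        case 2
        then have "g 0 = - g 1" using sumg by (simp add: add_eq_0_iff2)
        then have "order c (g 0) = order c (g 1)" for c by simp
        then have "orders (f (h 0)) = orders (f (h 1))"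
          using gord 2 by (auto simp: orders_def fun_eq_iff)
        then have "h 0 = h 1" using less.prems(5) hJ 2 by (auto simp: inj_on_def)
        then show False using hinj 2 by (auto simp: inj_on_def)
      qed
    qed
    \<comment> \<open>At most five elements give \<open>r \<le> 4\<close>, so the condition for
      \<open>r = 5\<close> is vacuous.\<close>
    ultimately show False
      using wronskian_circuit_contradiction[of r k g] k r less.prems(2,4) gnz gord hJ sumg by simp
  qed
qed

text \<open>Within a class all terms are multiples of one representative. Representatives of
  different classes have distinct orders, so the relation between them is trivial.\<close>

lemma sum_orders_class_eq_0:
  fixes f :: "'b \<Rightarrow> 'a::{alg_closed_field, field_char_0} poly"
  assumes k: "18 \<le> k" and I: "finite I" and nz: "\<And>i. i \<in> I \<Longrightarrow> f i \<noteq> 0"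
    and dvd: "\<And>i c. i \<in> I \<Longrightarrow> k dvd order c (f i)"
    and sum0: "(\<Sum>i\<in>I. f i) = 0" and card: "card ((\<lambda>i. orders (f i)) ` I) \<le> 5"
  shows "(\<Sum>i | i \<in> I \<and> orders (f i) = \<kappa>. f i) = 0"
proof (cases "\<kappa> \<in> (\<lambda>i. orders (f i)) ` I")
  case False
  then have "{i. i \<in> I \<and> orders (f i) = \<kappa>} = {}" by auto
  then show ?thesis by (simp only: sum.empty)
next
  case \<kappa>: True
  define K where "K = (\<lambda>i. orders (f i)) ` I"
  define \<rho> where "\<rho> = inv_into I (\<lambda>i. orders (f i))"
  have \<rho>: "\<rho> \<kappa> \<in> I" "orders (f (\<rho> \<kappa>)) = \<kappa>" if "\<kappa> \<in> K" for \<kappa>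
    using that f_inv_into_f[of \<kappa> "\<lambda>i. orders (f i)" I] inv_into_into[of \<kappa> "\<lambda>i. orders (f i)" I]
    by (simp_all add: \<rho>_def K_def)
  have "\<forall>i\<in>I. \<exists>a. f i = smult a (f (\<rho> (orders (f i))))"
  proof
    fix i assume i: "i \<in> I"
    then have "orders (f i) \<in> K" by (simp add: K_def)
    then show "\<exists>a. f i = smult a (f (\<rho> (orders (f i))))"
      using orders_eq_imp_smult[of "f i" "f (\<rho> (orders (f i)))"] \<rho> nz i by metis
  qed
  then obtain a where a: "\<And>i. i \<in> I \<Longrightarrow> f i = smult (a i) (f (\<rho> (orders (f i))))"
    by metis
  define s where "s \<kappa> = (\<Sum>i | i \<in> I \<and> orders (f i) = \<kappa>. a i)" for \<kappa>
  have class_sum: "(\<Sum>i | i \<in> I \<and> orders (f i) = \<kappa>. f i) = smult (s \<kappa>) (f (\<rho> \<kappa>))" for \<kappa>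
    unfolding s_def smult_sum using a by (intro sum.cong) force+
  have "(\<Sum>\<kappa>\<in>K. smult (s \<kappa>) (f (\<rho> \<kappa>))) = (\<Sum>i\<in>I. f i)"
    unfolding class_sum[symmetric] K_def using I by (intro sum.group) auto
  then have "s \<kappa> = 0"
    using linear_independent_powers[of k K "\<lambda>\<kappa>. f (\<rho> \<kappa>)" s \<kappa>] k I card \<rho> nz dvd sum0 \<kappa>
    by (auto simp: K_def inj_on_def)
  then show ?thesis by (simp add: class_sum)
qed

section \<open>Six terms\<close>

text \<open>\<open>A\<close> says that no class is a singleton, \<open>B\<close> that no class
  consists of one \<open>x\<close> and one \<open>y\<close>. If \<open>x0\<close> and
  \<open>y0\<close> differ, these leave just two classes; by \<open>C\<close>, at a point where the
  two differ, each class has as many \<open>x\<close> as \<open>y\<close>, so one of them is a mixed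
  pair.\<close>

lemma balanced_coloring:
  fixes x0 x1 x2 y0 y1 y2 :: "'b \<Rightarrow> nat"
  assumes A:
    "x0 \<in> {x1, x2, y0, y1, y2}" "x1 \<in> {x0, x2, y0, y1, y2}" "x2 \<in> {x0, x1, y0, y1, y2}"
    "y0 \<in> {x0, x1, x2, y1, y2}" "y1 \<in> {x0, x1, x2, y0, y2}" "y2 \<in> {x0, x1, x2, y0, y1}"
    and B:
    "x0 = y0 \<Longrightarrow> x0 \<in> {x1, x2, y1, y2}" "x0 = y1 \<Longrightarrow> x0 \<in> {x1, x2, y0, y2}" "x0 = y2 \<Longrightarrow> x0 \<in> {x1, x2, y0, y1}"
    "x1 = y0 \<Longrightarrow> x1 \<in> {x0, x2, y1, y2}" "x1 = y1 \<Longrightarrow> x1 \<in> {x0, x2, y0, y2}" "x1 = y2 \<Longrightarrow> x1 \<in> {x0, x2, y0, y1}"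
    "x2 = y0 \<Longrightarrow> x2 \<in> {x0, x1, y1, y2}" "x2 = y1 \<Longrightarrow> x2 \<in> {x0, x1, y0, y2}" "x2 = y2 \<Longrightarrow> x2 \<in> {x0, x1, y0, y1}"
    and C: "\<And>c. x0 c + x1 c + x2 c = y0 c + y1 c + y2 c"
  shows "x0 = y0"
proof (rule ccontr)
  assume ne: "x0 \<noteq> y0"
  then obtain c where c: "x0 c \<noteq> y0 c" by auto
  have "x1 = x0 \<or> x1 = y0" "x2 = x0 \<or> x2 = y0" "y1 = x0 \<or> y1 = y0" "y2 = x0 \<or> y2 = y0"
    using A[unfolded insert_iff empty_iff] B[unfolded insert_iff empty_iff] ne by smt+
  then show False
    using C[of c] c B ne by (elim disjE) auto
qed

lemma ex_other_of_sum_subset_eq_0: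
  assumes "finite I" "(\<Sum>i | i \<in> I \<and> P i. f i) = 0" "S \<subseteq> {i \<in> I. P i}" "sum f S \<noteq> (0 :: 'c::comm_monoid_add)"
  shows "\<exists>l\<in>I - S. P l"
proof (rule ccontr)
  assume "\<not> ?thesis"
  then have "{i. i \<in> I \<and> P i} = S" using assms(3) by auto
  then show False using assms(2,4) by simp
qed

text \<open>Indices up to 2 stand for even permutations, the others for odd ones. Were all six
  orders distinct, the first five terms would be independent and the Mason-Stothers count would
  apply to all six. So there are at most five classes, and each sums to zero.\<close>

lemma six_powers_sum_zero:
  fixes f :: "nat \<Rightarrow> 'a::{alg_closed_field, field_char_0} poly"
  assumes k: "18 \<le> k" and nz: "\<And>i. i \<le> 5 \<Longrightarrow> f i \<noteq> 0"
    and dvd: "\<And>i c. i \<le> 5 \<Longrightarrow> k dvd order c (f i)"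
    and sum0: "(\<Sum>i\<le>5. f i) = 0"
    and bal: "\<And>c. order c (f 0) + order c (f 1) + order c (f 2) = order c (f 3) + order c (f 4) + order c (f 5)"
    and pair: "\<And>i j. i \<le> 2 \<Longrightarrow> 3 \<le> j \<Longrightarrow> j \<le> 5 \<Longrightarrow> f i + f j \<noteq> 0"
  shows "orders (f 0) = orders (f 3)"
proof -
  have six: "j \<le> 5 \<longleftrightarrow> j = 0 \<or> j = 1 \<or> j = 2 \<or> j = 3 \<or> j = 4 \<or> j = 5" for j :: nat by auto
  have "card ((\<lambda>i. orders (f i)) ` {..5}) \<noteq> 6"
  proof
    assume "card ((\<lambda>i. orders (f i)) ` {..5}) = 6"
    then have inj: "inj_on (\<lambda>i. orders (f i)) {..5}" by (intro eq_card_imp_inj_on) auto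
    have "wronskian 5 f \<noteq> 0"
    proof (rule wronskian_nonzero)
      show "a i = 0" if "(\<Sum>i<5. smult (a i) (f i)) = 0" "i < 5" for a i
        using linear_independent_powers[of k "{..<5}" f a i] that k nz dvd inj_on_subset[OF inj, of "{..<5}"]
        by (simp add: subset_iff)
    qed
    moreover have "card {i\<in>{..5}. order c (f i) \<noteq> order c (f m)} \<noteq> 1" if "m \<le> 5" for c m
    proof
      assume "card {i\<in>{..5}. order c (f i) \<noteq> order c (f m)} = 1"
      then obtain j where j: "{i\<in>{..5}. order c (f i) \<noteq> order c (f m)} = {j}"
        by (auto simp: card_1_singleton_iff)
      then have "j \<le> 5" "order c (f j) \<noteq> order c (f m)" by auto
      moreover have "order c (f i) = order c (f m)" if "i \<le> 5" "i \<noteq> j" for i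
        using j that by auto
      ultimately show False
        using bal[of c] unfolding six by (elim disjE) simp_all
    qed
    ultimately show False
      using wronskian_circuit_contradiction[of 5 k f] k nz dvd sum0 by simp
  qed
  moreover have "card ((\<lambda>i. orders (f i)) ` {..5}) \<le> 6"
    using card_image_le[of "{..5::nat}" "\<lambda>i. orders (f i)"] by simp
  ultimately have "card ((\<lambda>i. orders (f i)) ` {..5}) \<le> 5" by linarith
  then have class_sum: "(\<Sum>l | l \<in> {..5} \<and> orders (f l) = \<kappa>. f l) = 0" for \<kappa>
    using sum_orders_class_eq_0[of k "{..5}" f \<kappa>] k nz dvd sum0 by simp
  define h where "h i = orders (f i)" for i
  have set6: "{..5} = {0, 1, 2, 3, 4, 5 :: nat}" by auto
  have A: "h i \<in> h ` S" if "i \<le> 5" "{..5} \<subseteq> insert i S" for i S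
  proof -
    have "\<exists>l\<in>{..5} - {i}. orders (f l) = orders (f i)"
      by (rule ex_other_of_sum_subset_eq_0[OF _ class_sum]) (use nz that in auto)
    then show ?thesis using that(2) unfolding h_def by (metis Diff_iff image_eqI insert_iff subsetD)
  qed
  have B: "h i \<in> h ` S" if "i \<le> 2" "3 \<le> j" "j \<le> 5" "{..5} \<subseteq> {i, j} \<union> S" "h i = h j" for i j S
  proof -
    have "\<exists>l\<in>{..5} - {i, j}. orders (f l) = orders (f i)"
      by (rule ex_other_of_sum_subset_eq_0[OF _ class_sum]) (use pair that in \<open>auto simp: h_def\<close>)
    then show ?thesis using that(4) unfolding h_def by (metis Diff_iff Un_iff image_eqI subsetD)
  qed
  have "h 0 = h 3"
  proof (rule balanced_coloring[of _ "h 1" "h 2" _ "h 4" "h 5"])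
    show "h 0 c + h 1 c + h 2 c = h 3 c + h 4 c + h 5 c" for c
      using bal by (simp add: h_def orders_def)
    show "h 0 \<in> {h 1, h 2, h 3, h 4, h 5}" using A[of 0 "{1, 2, 3, 4, 5}"] by (simp add: set6)
    show "h 1 \<in> {h 0, h 2, h 3, h 4, h 5}" using A[of 1 "{0, 2, 3, 4, 5}"] by (simp add: set6)
    show "h 2 \<in> {h 0, h 1, h 3, h 4, h 5}" using A[of 2 "{0, 1, 3, 4, 5}"] by (simp add: set6)
    show "h 3 \<in> {h 0, h 1, h 2, h 4, h 5}" using A[of 3 "{0, 1, 2, 4, 5}"] by (simp add: set6)
    show "h 4 \<in> {h 0, h 1, h 2, h 3, h 5}" using A[of 4 "{0, 1, 2, 3, 5}"] by (simp add: set6)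
    show "h 5 \<in> {h 0, h 1, h 2, h 3, h 4}" using A[of 5 "{0, 1, 2, 3, 4}"] by (simp add: set6)
    show "h 0 = h 3 \<Longrightarrow> h 0 \<in> {h 1, h 2, h 4, h 5}" using B[of 0 3 "{1, 2, 4, 5}"] by (simp add: set6)
    show "h 0 = h 4 \<Longrightarrow> h 0 \<in> {h 1, h 2, h 3, h 5}" using B[of 0 4 "{1, 2, 3, 5}"] by (simp add: set6)
    show "h 0 = h 5 \<Longrightarrow> h 0 \<in> {h 1, h 2, h 3, h 4}" using B[of 0 5 "{1, 2, 3, 4}"] by (simp add: set6)
    show "h 1 = h 3 \<Longrightarrow> h 1 \<in> {h 0, h 2, h 4, h 5}" using B[of 1 3 "{0, 2, 4, 5}"] by (simp add: set6)
    show "h 1 = h 4 \<Longrightarrow> h 1 \<in> {h 0, h 2, h 3, h 5}" using B[of 1 4 "{0, 2, 3, 5}"] by (simp add: set6)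
    show "h 1 = h 5 \<Longrightarrow> h 1 \<in> {h 0, h 2, h 3, h 4}" using B[of 1 5 "{0, 2, 3, 4}"] by (simp add: set6)
    show "h 2 = h 3 \<Longrightarrow> h 2 \<in> {h 0, h 1, h 4, h 5}" using B[of 2 3 "{0, 1, 4, 5}"] by (simp add: set6)
    show "h 2 = h 4 \<Longrightarrow> h 2 \<in> {h 0, h 1, h 3, h 5}" using B[of 2 4 "{0, 1, 3, 5}"] by (simp add: set6)
    show "h 2 = h 5 \<Longrightarrow> h 2 \<in> {h 0, h 1, h 3, h 4}" using B[of 2 5 "{0, 1, 3, 4}"] by (simp add: set6)
  qed
  then show ?thesis by (simp add: h_def)
qed

section \<open>The vanishing determinant of the matrix \<open>M\<close>\<close>

lemma order_power: "p \<noteq> 0 \<Longrightarrow> order c (p ^ k) = k * order c (p :: 'a::idom poly)"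
  by (induction k) (auto simp: order_mult)

lemma sum_atMost_5: "(\<Sum>i\<le>5. g i) = g 0 + g 1 + g 2 + g 3 + g 4 + g (5 :: nat)"
  by (simp add: eval_nat_numeral atMost_Suc add_ac)

theorem proposition1p2:
  fixes n :: "'a::{alg_closed_field, field_char_0} poly"
    and A :: "'a poly set"
    and k :: nat
  assumes "n \<noteq> 0"
    and "k \<ge> 18"
    and "diophantine_tuple k n A"
  shows "\<nexists>(a :: nat \<Rightarrow> 'a poly) (b :: nat \<Rightarrow> 'a poly).
           {a 1, a 2, a 3, b 1, b 2, b 3} \<subseteq> A \<and>
           distinct [a 1, a 2, a 3, b 1, b 2, b 3] \<and>
           (\<forall>i\<in>{1..3}. \<forall>j\<in>{1..3}. a i * b j + n \<noteq> 0) \<and>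
           to_fract ((a 1 * b 1 + n) * (a 2 * b 2 + n)) /
           to_fract ((a 1 * b 2 + n) * (a 2 * b 1 + n)) \<notin> nonzero_constants"
proof (rule notI, elim exE conjE)
  fix a b :: "nat \<Rightarrow> 'a poly"
  assume sub: "{a 1, a 2, a 3, b 1, b 2, b 3} \<subseteq> A"
    and dist: "distinct [a 1, a 2, a 3, b 1, b 2, b 3]"
    and nz: "\<forall>i\<in>{1..3}. \<forall>j\<in>{1..3}. a i * b j + n \<noteq> 0"
    and quot: "to_fract ((a 1 * b 1 + n) * (a 2 * b 2 + n)) /
      to_fract ((a 1 * b 2 + n) * (a 2 * b 1 + n)) \<notin> nonzero_constants"
  define M where "M i j = a i * b j + n" for i j
  have three: "i \<in> {1..3} \<longleftrightarrow> i = 1 \<or> i = 2 \<or> i = 3" for i :: nat by auto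
  have M_nz: "M i j \<noteq> 0" if "i \<in> {1..3}" "j \<in> {1..3}" for i j
    using nz that by (simp add: M_def)
  have M_ord: "k dvd order c (M i j)" if "i \<in> {1..3}" "j \<in> {1..3}" for i j c
  proof -
    have "a i \<in> A" "b j \<in> A" "a i \<noteq> b j" using sub dist that unfolding three by auto
    then obtain z where z: "M i j = z ^ k"
      using assms(3) by (auto simp: diophantine_tuple_def M_def is_nth_power_def)
    then have "z \<noteq> 0" using M_nz[OF that] assms(2) by (auto simp: power_0_left)
    then show ?thesis using z by (simp add: order_power)
  qed
  have minor: "M i j * M i' j' \<noteq> M i j' * M i' j"
    if "i \<in> {1..3}" "i' \<in> {1..3}" "j \<in> {1..3}" "j' \<in> {1..3}" "i \<noteq> i'" "j \<noteq> j'" for i i' j j'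
  proof -
    have "a i \<noteq> a i'" "b j \<noteq> b j'" using dist that unfolding three by auto
    moreover have "M i j * M i' j' - M i j' * M i' j = n * (a i - a i') * (b j - b j')"
      by (simp add: M_def algebra_simps)
    ultimately have "M i j * M i' j' - M i j' * M i' j \<noteq> 0" using assms(1) by simp
    then show ?thesis by simp
  qed
  \<comment> \<open>The signed Leibniz terms, even permutations first. Positions 0 and 3 hold the
    identity and the transposition of 1 and 2, which share the factor \<open>M 3 3\<close>.\<close>
  define f where "f = (\<lambda>l. [M 1 1 * M 2 2 * M 3 3, M 1 2 * M 2 3 * M 3 1, M 1 3 * M 2 1 * M 3 2,
      - (M 1 2 * M 2 1 * M 3 3), - (M 1 1 * M 2 3 * M 3 2), - (M 1 3 * M 2 2 * M 3 1)] ! l)"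
  have f: "f 0 = M 1 1 * M 2 2 * M 3 3" "f 1 = M 1 2 * M 2 3 * M 3 1" "f 2 = M 1 3 * M 2 1 * M 3 2"
    "f 3 = - (M 1 2 * M 2 1 * M 3 3)" "f 4 = - (M 1 1 * M 2 3 * M 3 2)" "f 5 = - (M 1 3 * M 2 2 * M 3 1)"
    by (simp_all add: f_def)
  have six: "l \<le> 5 \<longleftrightarrow> l = 0 \<or> l = 1 \<or> l = 2 \<or> l = 3 \<or> l = 4 \<or> l = 5" for l :: nat by auto
  have "orders (f 0) = orders (f 3)"
  proof (rule six_powers_sum_zero[OF assms(2)])
    show "f l \<noteq> 0" if "l \<le> 5" for l
      using that unfolding six by (elim disjE) (simp_all add: f f[unfolded One_nat_def] M_nz)
    show "k dvd order c (f l)" if "l \<le> 5" for l c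
      using that unfolding six by (elim disjE) (simp_all add: f f[unfolded One_nat_def] M_nz M_ord order_mult)
    \<comment> \<open>\<open>M\<close> is a sum of two matrices of rank at most one.\<close>
    show "(\<Sum>l\<le>5. f l) = 0"
      unfolding sum_atMost_5 f M_def by (simp add: algebra_simps)
    \<comment> \<open>The even terms together use each of the nine entries once, and so do the odd
      terms.\<close>
    show "order c (f 0) + order c (f 1) + order c (f 2) = order c (f 3) + order c (f 4) + order c (f 5)" for c
      unfolding f by (simp add: M_nz order_mult)
    show "f i + f j \<noteq> 0" if "i \<le> 2" "3 \<le> j" "j \<le> 5" for i j
    proof -
      \<comment> \<open>An even and an odd permutation of three letters agree at exactly one place,
        so each sum is that entry times a 2 by 2 minor up to sign.\<close>
      have "f 0 + f 3 = M 3 3 * (M 1 1 * M 2 2 - M 1 2 * M 2 1)"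
        "f 0 + f 4 = M 1 1 * (M 2 2 * M 3 3 - M 2 3 * M 3 2)"
        "f 0 + f 5 = M 2 2 * (M 1 1 * M 3 3 - M 1 3 * M 3 1)"
        "f 1 + f 3 = M 1 2 * (M 2 3 * M 3 1 - M 2 1 * M 3 3)"
        "f 1 + f 4 = M 2 3 * (M 1 2 * M 3 1 - M 1 1 * M 3 2)"
        "f 1 + f 5 = M 3 1 * (M 1 2 * M 2 3 - M 1 3 * M 2 2)"
        "f 2 + f 3 = M 2 1 * (M 1 3 * M 3 2 - M 1 2 * M 3 3)"
        "f 2 + f 4 = M 3 2 * (M 1 3 * M 2 1 - M 1 1 * M 2 3)"
        "f 2 + f 5 = M 1 3 * (M 2 1 * M 3 2 - M 2 2 * M 3 1)"
        by (simp_all only: f) (simp_all add: algebra_simps)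
      note factor = this
      have "i = 0 \<or> i = 1 \<or> i = 2" "j = 3 \<or> j = 4 \<or> j = 5" using that by auto
      then show ?thesis
        by (elim disjE; simp only: factor mult_eq_0_iff right_minus_eq) (simp_all add: minor M_nz)
    qed
  qed
  then have "order c (M 1 1 * M 2 2) = order c (M 1 2 * M 2 1)" for c
    using M_nz by (auto simp: f orders_def fun_eq_iff order_mult dest!: spec[of _ c])
  then have "orders (M 1 1 * M 2 2) = orders (M 1 2 * M 2 1)"
    by (simp add: orders_def fun_eq_iff)
  then obtain s where s: "s \<noteq> 0" "M 1 1 * M 2 2 = smult s (M 1 2 * M 2 1)"
    using orders_eq_imp_smult[of "M 1 1 * M 2 2" "M 1 2 * M 2 1"] M_nz by auto
  have "to_fract (M 1 1 * M 2 2) / to_fract (M 1 2 * M 2 1) = to_fract [:s:]"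
  proof -
    have "to_fract (M 1 1 * M 2 2) = to_fract [:s:] * to_fract (M 1 2 * M 2 1)"
      unfolding s(2) by (simp flip: to_fract_mult)
    moreover have "to_fract (M 1 2 * M 2 1) \<noteq> 0"
      using M_nz[of 1 2] M_nz[of 2 1] by (simp del: to_fract_mult)
    ultimately show ?thesis by (simp del: to_fract_mult)
  qed
  then show False
    using quot s(1) unfolding M_def nonzero_constants_def by blast
qed

end
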